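(* Let $u$ be a finite nonempty factor of the Thue-Morse word $\mathbb{T}$. Then: (1) If $u$ is a prefix of $\mathbb{T}$, then $\mathbb{T}|_u$ is an IP-set. (2) If $u$ is a prefix of $\overline{\mathbb{T}}$, then $\mathbb{T}|_u$ is infinite FS-big but is not an IP-set. (3) If $u$ is neither a prefix of $\mathbb{T}$ nor a prefix of $\overline{\mathbb{T}}$, then $\mathbb{T}|_u$ is not $3$-summable. Moreover, $\mathbb{T}|_u$ is $2$-summable if and only if $u$ is a prefix of $\tau^n(010)$ or of $\tau^n(101)$ for some $n\geq 0$.
   Context: $\mathbb{N}$ denotes the set of positive integers. The Thue-Morse word is $\mathbb{T}=t_0t_1t_2\ldots\in\{0,1\}^\omega$, where $t_n$ is the sum modulo $2$ of the binary digits of $n$; equivalently, $\mathbb{T}$ is the fixed point beginning with $0$ of the morphism $\tau:0\mapsto 01,\ 1\mapsto 10$. $\overline{\mathbb{T}}$ is obtained from $\mathbb{T}$ by exchanging $0$'s and $1$'s (the fixed point of $\tau$ beginning with $1$). For a factor $u$ of $\mathbb{T}$, $\mathbb{T}|_u=\{n\in\mathbb{N}\,:\,t_nt_{n+1}\cdots t_{n+|u|-1}=u\}$, the set of occurrences of $u$ in $\mathbb{T}$. A sequence (finite or infinite) $\langle x_t\rangle$ in $\mathbb{N}$ satisfies uniqueness of finite sums if whenever $F,H$ are finite nonempty subsets of its index set with $\sum_{t\in F}x_t=\sum_{t\in H}x_t$, then $F=H$. A set $A\subseteq\mathbb{N}$ is $k$-summable if $A$ contains $\{\sum_{t\in F}x_t:\emptyset\neq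 F\subseteq\{1,\dots,k\}\}$ for some sequence $\langle x_t\rangle_{t=1}^k$ in $\mathbb{N}$ satisfying uniqueness of finite sums. $A$ is $k^\infty$-summable if there is an infinite sequence $\langle x_t\rangle_{t=1}^\infty$ in $\mathbb{N}$ satisfying uniqueness of finite sums such that $A$ contains $\{\sum_{t\in F}x_t:\emptyset\neq F\subseteq\mathbb{N},\ \#F\leq k\}$. $A$ is infinite FS-big if it is $k^\infty$-summable for every positive integer $k$. $A$ is an IP-set if there is an infinite sequence $\langle x_t\rangle_{t=1}^\infty$ in $\mathbb{N}$ with $\{\sum_{t\in F}x_t:F\text{ finite nonempty}\subseteq\mathbb{N}\}\subseteq A$. *)

theory Defs
  imports Complex_Main "HOL-Library.Sublist"
begin

text \<open>Letters are the naturals 0 and 1; finite words are lists, infinite words are functions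
  indexed from 0. The positive integers are the naturals \<open>n > 0\<close>.\<close>

fun bin_digit_sum :: "nat \<Rightarrow> nat" where
  "bin_digit_sum n = (if n = 0 then 0 else n mod 2 + bin_digit_sum (n div 2))"

declare bin_digit_sum.simps [simp del]

definition thue_morse :: "nat \<Rightarrow> nat" where
  "thue_morse n = bin_digit_sum n mod 2"

definition thue_morse_bar :: "nat \<Rightarrow> nat" where
  "thue_morse_bar n = 1 - thue_morse n"

definition tau_letter :: "nat \<Rightarrow> nat list" where
  "tau_letter a = (if a = 0 then [0, 1] else [1, 0])"

definition tau :: "nat list \<Rightarrow> nat list" where
  "tau w = concat (map tau_letter w)"

definition occurs_at :: "'a list \<Rightarrow> (nat \<Rightarrow> 'a) \<Rightarrow> nat \<Rightarrow> bool" where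
  "occurs_at u w n \<longleftrightarrow> map w [n ..< n + length u] = u"

definition word_factor :: "'a list \<Rightarrow> (nat \<Rightarrow> 'a) \<Rightarrow> bool" where
  "word_factor u w \<longleftrightarrow> (\<exists>n. occurs_at u w n)"

definition word_prefix :: "'a list \<Rightarrow> (nat \<Rightarrow> 'a) \<Rightarrow> bool" where
  "word_prefix u w \<longleftrightarrow> occurs_at u w 0"

text \<open>Position 0 is excluded, as occurrence sets are sets of positive integers.\<close>

definition occurrences :: "(nat \<Rightarrow> 'a) \<Rightarrow> 'a list \<Rightarrow> nat set" where
  "occurrences w u = {n. n > 0 \<and> occurs_at u w n}"

text \<open>A sequence of positive integers is a function of which only the values on the index set
  \<open>I\<close> matter; \<open>I\<close> is \<open>{1..k}\<close> or \<open>{1..}\<close>.\<close>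

definition unique_finite_sums :: "nat set \<Rightarrow> (nat \<Rightarrow> nat) \<Rightarrow> bool" where
  "unique_finite_sums I x \<longleftrightarrow>
     (\<forall>F H. finite F \<and> F \<noteq> {} \<and> F \<subseteq> I \<and> finite H \<and> H \<noteq> {} \<and> H \<subseteq> I \<and>
        (\<Sum>t\<in>F. x t) = (\<Sum>t\<in>H. x t) \<longrightarrow> F = H)"

definition k_summable :: "nat \<Rightarrow> nat set \<Rightarrow> bool" where
  "k_summable k A \<longleftrightarrow>
     (\<exists>x :: nat \<Rightarrow> nat. (\<forall>t\<in>{1..k}. x t > 0) \<and> unique_finite_sums {1..k} x \<and>
        {\<Sum>t\<in>F. x t |F. F \<noteq> {} \<and> F \<subseteq> {1..k}} \<subseteq> A)"

definition k_inf_summable :: "nat \<Rightarrow> nat set \<Rightarrow> bool" where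
  "k_inf_summable k A \<longleftrightarrow>
     (\<exists>x :: nat \<Rightarrow> nat. (\<forall>t\<in>{1..}. x t > 0) \<and> unique_finite_sums {1..} x \<and>
        {\<Sum>t\<in>F. x t |F. finite F \<and> F \<noteq> {} \<and> F \<subseteq> {1..} \<and> card F \<le> k} \<subseteq> A)"

definition infinite_FS_big :: "nat set \<Rightarrow> bool" where
  "infinite_FS_big A \<longleftrightarrow> (\<forall>k>0. k_inf_summable k A)"

definition IP_set :: "nat set \<Rightarrow> bool" where
  "IP_set A \<longleftrightarrow>
     (\<exists>x :: nat \<Rightarrow> nat. (\<forall>t\<in>{1..}. x t > 0) \<and>
        {\<Sum>t\<in>F. x t |F. finite F \<and> F \<noteq> {} \<and> F \<subseteq> {1..}} \<subseteq> A)"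

end

theory Submission
  imports Defs
begin

text \<open>
  The parity of the binary digit sum is additive on sums without carries:
  \<open>t (2^m * q + r) = t q + t r\<close> (mod 2) for \<open>r < 2^m\<close>. Prefixes \<open>u\<close> of the Thue-Morse word
  therefore occur at all \<open>2^m * q\<close> with \<open>t q = 0\<close>, and the sequence \<open>3 * 4^i\<close> gives an IP-set.
  For prefixes of the complement one needs \<open>t q = 1\<close>. Here \<open>3 * 2^N * 4^i + d\<close> with
  \<open>d = 2^K - 1\<close>, \<open>K\<close> odd, works for sums of at most \<open>k \<le> 2^K\<close> terms, because every multiple
  \<open>j * d\<close> with \<open>1 \<le> j \<le> 2^K\<close> has digit sum \<open>K\<close>. An IP-set of positions with \<open>t = 1\<close> is
  impossible: some finite sum \<open>y\<close> avoiding \<open>x 1\<close> is divisible by a power of 2 exceeding \<open>x 1\<close>,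
  and then \<open>t (x 1 + y) = 0\<close>.

  All occurrences of a factor of length at least 4 have the same parity. If they are odd, no sum
  of two occurrences is an occurrence; if they are even, one desubstitutes \<open>\<tau>\<close> and halves the
  occurrences. This leads to factors of length at most 3, where only 010 and 101
  remain; these occur only at positions congruent to 2 or 3 modulo 4, and no three such
  numbers have all their subset sums in these classes.
\<close>

subsection \<open>The Thue-Morse sequence\<close>

lemma thue_morse_0 [simp]: "thue_morse 0 = 0"
  by (simp add: thue_morse_def bin_digit_sum.simps)

lemma thue_morse_double [simp]: "thue_morse (2 * n) = thue_morse n"
  by (cases "n = 0") (simp_all add: thue_morse_def bin_digit_sum.simps[of "2 * n"])

lemma thue_morse_le_1: "thue_morse n \<le> 1"
  by (simp add: thue_morse_def)

lemma thue_morse_Suc_double [simp]: "thue_morse (Suc (2 * n)) = 1 - thue_morse n"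
proof -
  have "thue_morse (Suc (2 * n)) = Suc (bin_digit_sum n) mod 2"
    by (simp add: thue_morse_def bin_digit_sum.simps[of "Suc (2 * n)"])
  then show ?thesis
    unfolding thue_morse_def by presburger
qed

text \<open>Lets the simplifier evaluate the sequence at explicit numerals, such as the witnesses in
  \<open>k_summable_2_tau_power\<close>.\<close>

lemma thue_morse_numeral [simp]:
  "thue_morse (Suc 0) = 1"
  "thue_morse (numeral Num.One) = 1"
  "thue_morse (numeral (Num.Bit0 n)) = thue_morse (numeral n)"
  "thue_morse (numeral (Num.Bit1 n)) = 1 - thue_morse (numeral n)"
proof -
  show *: "thue_morse (Suc 0) = 1"
    using thue_morse_Suc_double[of 0] by simp
  then show "thue_morse (numeral Num.One) = 1"
    by simp
  show "thue_morse (numeral (Num.Bit0 n)) = thue_morse (numeral n)"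
    by (metis thue_morse_double mult_2 numeral_Bit0)
  show "thue_morse (numeral (Num.Bit1 n)) = 1 - thue_morse (numeral n)"
    using thue_morse_Suc_double[of "numeral n"]
    by (metis Suc_eq_plus1 mult_2 numeral_Bit1)
qed

lemma thue_morse_add_no_carry:
  assumes "r < 2 ^ m"
  shows "thue_morse (2 ^ m * q + r) = (thue_morse q + thue_morse r) mod 2"
  using assms
proof (induction m arbitrary: r)
  case 0
  then show ?case
    using thue_morse_le_1[of q] by simp
next
  case (Suc m)
  define r' where "r' = r div 2"
  have IH: "thue_morse (2 ^ m * q + r') = (thue_morse q + thue_morse r') mod 2"
    using Suc by (simp add: r'_def)
  show ?case
  proof (cases "even r")
    case True
    then have r: "r = 2 * r'" by (simp add: r'_def)
    have "2 ^ Suc m * q + r = 2 * (2 ^ m * q + r')" by (simp add: r)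
    then show ?thesis
      using IH by (simp only: thue_morse_double r)
  next
    case False
    then have r: "r = Suc (2 * r')" by (simp add: r'_def)
    have "2 ^ Suc m * q + r = Suc (2 * (2 ^ m * q + r'))" by (simp add: r)
    then have "thue_morse (2 ^ Suc m * q + r) = 1 - (thue_morse q + thue_morse r') mod 2"
      using IH by (simp only: thue_morse_Suc_double)
    also have "\<dots> = (thue_morse q + (1 - thue_morse r')) mod 2"
    proof (cases "thue_morse r' = 0")
      case True
      then show ?thesis by (simp add: mod_Suc)
    next
      case False
      then have "thue_morse r' = 1" using thue_morse_le_1[of r'] by simp
      then show ?thesis using thue_morse_le_1[of q] by (auto simp: mod_Suc)
    qed
    finally show ?thesis by (simp only: r thue_morse_Suc_double)
  qed
qed

text \<open>Subtraction from \<open>2 ^ K - 1\<close> flips each of \<open>K\<close> binary digits,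
  so the two digit sums add up to \<open>K\<close>.\<close>

lemma thue_morse_complement:
  assumes "r < 2 ^ K"
  shows "thue_morse (2 ^ K - 1 - r) = (K + thue_morse r) mod 2"
  using assms
proof (induction K arbitrary: r)
  case 0
  then show ?case by simp
next
  case (Suc K)
  define r' where "r' = r div 2"
  have less: "r' < 2 ^ K" using Suc.prems by (simp add: r'_def)
  have IH: "thue_morse (2 ^ K - 1 - r') = (K + thue_morse r') mod 2"
    using Suc.IH less .
  have eq: "1 - a mod 2 = Suc a mod 2" for a :: nat
    by (simp add: mod_Suc)
  show ?case
  proof (cases "even r")
    case True
    then have r: "r = 2 * r'" by (simp add: r'_def)
    have "2 ^ Suc K - 1 - r = Suc (2 * (2 ^ K - 1 - r'))" using less by (simp add: r)
    then have "thue_morse (2 ^ Suc K - 1 - r) = 1 - (K + thue_morse r') mod 2"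
      using IH by (simp only: thue_morse_Suc_double)
    then show ?thesis
      by (simp only: eq r thue_morse_double add_Suc)
  next
    case False
    then have r: "r = Suc (2 * r')" by (simp add: r'_def)
    have "2 ^ Suc K - 1 - r = 2 * (2 ^ K - 1 - r')" using less by (simp add: r)
    then have "thue_morse (2 ^ Suc K - 1 - r) = (K + thue_morse r') mod 2"
      using IH by (simp only: thue_morse_double)
    also have "\<dots> = (Suc K + (1 - thue_morse r')) mod 2"
      using thue_morse_le_1[of r'] by (cases "thue_morse r'") auto
    finally show ?thesis by (simp only: r thue_morse_Suc_double)
  qed
qed

text \<open>The product is \<open>2 ^ K * (j - 1) + (2 ^ K - 1 - (j - 1))\<close>: the digits of
  \<open>j - 1\<close> followed by their \<open>K\<close>-digit complement, together
  \<open>K\<close> ones.\<close>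

lemma thue_morse_mult_mersenne:
  assumes "0 < j" "j \<le> 2 ^ K"
  shows "thue_morse (j * (2 ^ K - 1)) = K mod 2"
proof -
  define i where "i = j - 1"
  have j: "j = Suc i" and i: "i < 2 ^ K" using assms by (auto simp: i_def)
  obtain c where c: "(2::nat) ^ K = Suc (i + c)" using i less_imp_Suc_add by blast
  have "j * (2 ^ K - 1) = 2 ^ K * i + (2 ^ K - 1 - i)"
    by (simp add: j c algebra_simps)
  also have "thue_morse \<dots> = (thue_morse i + (K + thue_morse i) mod 2) mod 2"
    using thue_morse_add_no_carry[of "2 ^ K - 1 - i" K i] thue_morse_complement[OF i] i by simp
  also have "\<dots> = K mod 2" by presburger
  finally show ?thesis .
qed

lemma sum_less_power_4:
  assumes "finite F" "\<And>i. i \<in> F \<Longrightarrow> i < b"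
  shows "(\<Sum>i\<in>F. 3 * 4 ^ i) < (4 ^ b :: nat)"
proof -
  have "(\<Sum>i\<in>F. 3 * 4 ^ i) \<le> (\<Sum>i<b. 3 * 4 ^ i :: nat)"
    using assms by (intro sum_mono2) auto
  also have "\<dots> < 4 ^ b" by (induction b) auto
  finally show ?thesis .
qed

text \<open>In binary, \<open>3 * 4 ^ i\<close> is a block 11 at positions \<open>2 * i\<close> and
  \<open>2 * i + 1\<close>. Blocks for distinct \<open>i\<close> are disjoint, so the number of ones
  is even.\<close>

lemma thue_morse_sum_power_4:
  "finite F \<Longrightarrow> thue_morse (\<Sum>i\<in>F. 3 * 4 ^ i) = 0"
proof (induction F rule: finite_linorder_max_induct)
  case (insert b A)
  have "(\<Sum>i\<in>insert b A. 3 * 4 ^ i :: nat) = 2 ^ (2 * b) * 3 + (\<Sum>i\<in>A. 3 * 4 ^ i)"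
    using insert by (subst sum.insert) (auto simp: power_mult)
  moreover have "(\<Sum>i\<in>A. 3 * 4 ^ i :: nat) < 2 ^ (2 * b)"
    using sum_less_power_4[of A b] insert by (simp add: power_mult)
  ultimately show ?case
    using thue_morse_add_no_carry[of "\<Sum>i\<in>A. 3 * 4 ^ i" "2 * b" 3] insert.IH by simp
qed simp

text \<open>At every even position starts the image of a letter under \<open>tau\<close>, whose two
  letters differ.\<close>

lemma thue_morse_square_odd:
  assumes "thue_morse n = thue_morse (Suc n)"
  shows "odd n"
proof
  assume "even n"
  then obtain i where "n = 2 * i" by blast
  then have "thue_morse i = 1 - thue_morse i" using assms by simp
  then show False by arith
qed

lemma thue_morse_no_cube:
  "\<not> (thue_morse n = thue_morse (Suc n) \<and> thue_morse n = thue_morse (Suc (Suc n)))"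
  using thue_morse_square_odd[of n] thue_morse_square_odd[of "Suc n"] by auto

subsection \<open>Occurrences\<close>

lemma occurs_at_iff_nth: "occurs_at u w n \<longleftrightarrow> (\<forall>k<length u. w (n + k) = u ! k)"
  unfolding occurs_at_def list_eq_iff_nth_eq by simp

lemma occurs_at_Nil [simp]: "occurs_at [] w n"
  by (simp add: occurs_at_def)

lemma occurs_at_Cons [simp]:
  "occurs_at (a # u) w n \<longleftrightarrow> w n = a \<and> occurs_at u w (Suc n)"
  by (simp add: occurs_at_def upt_conv_Cons del: upt_Suc)

lemma occurs_at_prefix: "prefix u v \<Longrightarrow> occurs_at v w n \<Longrightarrow> occurs_at u w n"
  by (auto simp: occurs_at_iff_nth prefix_def nth_append)

lemma prefix_if_occurs_at:
  assumes "occurs_at u w n" "occurs_at v w n" "length u \<le> length v"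
  shows "prefix u v"
proof -
  have "take (length u) v = u"
    using assms by (intro nth_equalityI) (auto simp: occurs_at_iff_nth)
  then show ?thesis using take_is_prefix[of "length u" v] by simp
qed

lemma tau_Cons: "tau (a # u) = tau_letter a @ tau u"
  by (simp add: tau_def)

lemma tau_append: "tau (u @ v) = tau u @ tau v"
  by (simp add: tau_def)

lemma length_tau: "length (tau u) = 2 * length u"
  by (induction u) (simp_all add: tau_def tau_letter_def)

lemma prefix_tau: "prefix u v \<Longrightarrow> prefix (tau u) (tau v)"
  by (auto simp: prefix_def tau_append)

text \<open>Stated for any binary word with the recurrences of a fixed point of \<open>tau\<close>,
  so that it serves both the Thue-Morse word and its complement.\<close>

lemma occurs_at_tau:
  assumes "\<And>n. w (2 * n) = w n" "\<And>n. w (Suc (2 * n)) = 1 - w n" "\<And>n. w n \<le> (1::nat)"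
    and "occurs_at u w n"
  shows "occurs_at (tau u) w (2 * n)"
  using assms(4)
proof (induction u arbitrary: n)
  case Nil
  then show ?case by (simp add: tau_def)
next
  case (Cons a u)
  then have "occurs_at (tau u) w (Suc (Suc (2 * n)))"
    using Cons.IH[of "Suc n"] by simp
  moreover have "w (2 * n) = a" "w (Suc (2 * n)) = 1 - a" "a \<le> 1"
    using Cons.prems assms(1)[of n] assms(2)[of n] assms(3)[of n] by simp_all
  ultimately show ?case
    by (cases "a = 0") (simp_all add: tau_Cons tau_letter_def)
qed

lemmas occurs_at_tau_thue_morse =
  occurs_at_tau[of thue_morse, OF thue_morse_double thue_morse_Suc_double thue_morse_le_1]

lemma word_prefix_tau_thue_morse:
  "word_prefix u thue_morse \<Longrightarrow> word_prefix (tau u) thue_morse"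
  using occurs_at_tau_thue_morse[of u 0] by (simp add: word_prefix_def)

lemma word_prefix_tau_thue_morse_bar:
  "word_prefix u thue_morse_bar \<Longrightarrow> word_prefix (tau u) thue_morse_bar"
  using occurs_at_tau[of thue_morse_bar u 0] thue_morse_le_1
  by (simp add: word_prefix_def thue_morse_bar_def)

text \<open>Comparing the four letters from \<open>2 * i\<close> with those from
  \<open>Suc (2 * j)\<close> forces equal letters at \<open>j\<close>, \<open>Suc j\<close> and
  \<open>Suc (Suc j)\<close>, a cube.\<close>

lemma occurs_at_same_parity:
  assumes u: "4 \<le> length u" and n: "occurs_at u thue_morse n" and n': "occurs_at u thue_morse n'"
    and "even n"
  shows "even n'"
proof (rule ccontr)
  assume "odd n'"
  obtain i where i: "n = 2 * i" using \<open>even n\<close> by blast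
  obtain j where j: "n' = Suc (2 * j)" using \<open>odd n'\<close> by (metis oddE Suc_eq_plus1)
  have eq: "thue_morse (2 * i + k) = thue_morse (Suc (2 * j) + k)" if "k < 4" for k
    using n n' u that unfolding occurs_at_iff_nth i j by force
  have "thue_morse i = 1 - thue_morse j"
    using eq[of 0] by simp
  moreover have "1 - thue_morse i = thue_morse (Suc j)"
    using eq[of 1] thue_morse_double[of "Suc j"] by simp
  moreover have "thue_morse (Suc i) = 1 - thue_morse (Suc j)"
    using eq[of 2] thue_morse_double[of "Suc i"] thue_morse_Suc_double[of "Suc j"] by simp
  moreover have "1 - thue_morse (Suc i) = thue_morse (Suc (Suc j))"
    using eq[of 3] thue_morse_Suc_double[of "Suc i"] thue_morse_double[of "Suc (Suc j)"]
    by (simp add: eval_nat_numeral)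
  ultimately show False
    using thue_morse_no_cube[of j] thue_morse_le_1[of j] thue_morse_le_1[of "Suc j"]
      thue_morse_le_1[of "Suc (Suc j)"] by linarith
qed

subsection \<open>Summability\<close>

text \<open>With \<open>c = 2\<close> this carries summability from a word to its
  desubstitution.\<close>

lemma k_summable_scaleD:
  assumes "k_summable k A" "A \<subseteq> (*) c ` B" "0 < c"
  shows "k_summable k B"
proof -
  obtain x where pos: "\<forall>t\<in>{1..k}. x t > 0" and uniq: "unique_finite_sums {1..k} x"
    and sums: "{\<Sum>t\<in>F. x t |F. F \<noteq> {} \<and> F \<subseteq> {1..k}} \<subseteq> A"
    using assms(1) unfolding k_summable_def by blast
  have mem: "(\<Sum>t\<in>F. x t) \<in> A" if "F \<noteq> {}" "F \<subseteq> {1..k}" for F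
    using sums that by blast
  \<comment> \<open>The division is exact: singleton sums lie in \<open>A\<close> and hence are
    multiples of \<open>c\<close>.\<close>
  define y where "y t = x t div c" for t
  have xy: "x t = c * y t" if "t \<in> {1..k}" for t
    using mem[of "{t}"] that assms(2) by (auto simp: y_def)
  have sum_xy: "(\<Sum>t\<in>F. x t) = c * (\<Sum>t\<in>F. y t)" if "F \<subseteq> {1..k}" for F
    unfolding sum_distrib_left using that by (intro sum.cong) (auto simp: xy)
  have "\<forall>t\<in>{1..k}. y t > 0"
    using pos xy by (metis gr0I mult_0_right less_irrefl)
  moreover have "unique_finite_sums {1..k} y"
    using uniq unfolding unique_finite_sums_def by (metis sum_xy)
  moreover have "{\<Sum>t\<in>F. y t |F. F \<noteq> {} \<and> F \<subseteq> {1..k}} \<subseteq> B"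
  proof clarify
    fix F assume F: "F \<noteq> {}" "F \<subseteq> {1..k}"
    then have "c * (\<Sum>t\<in>F. y t) \<in> (*) c ` B"
      using mem[OF F] sum_xy assms(2) by auto
    then show "(\<Sum>t\<in>F. y t) \<in> B" using \<open>0 < c\<close> by auto
  qed
  ultimately show ?thesis unfolding k_summable_def by blast
qed

lemma k_summable_scale:
  assumes "k_summable k A" "(*) c ` A \<subseteq> B" "0 < c"
  shows "k_summable k B"
proof -
  obtain x where pos: "\<forall>t\<in>{1..k}. x t > 0" and uniq: "unique_finite_sums {1..k} x"
    and sums: "{\<Sum>t\<in>F. x t |F. F \<noteq> {} \<and> F \<subseteq> {1..k}} \<subseteq> A"
    using assms(1) unfolding k_summable_def by blast
  define y where "y t = c * x t" for t
  have sum_y: "(\<Sum>t\<in>F. y t) = c * (\<Sum>t\<in>F. x t)" for F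
    by (simp add: y_def sum_distrib_left)
  have "\<forall>t\<in>{1..k}. y t > 0"
    using pos \<open>0 < c\<close> by (simp add: y_def)
  moreover have "unique_finite_sums {1..k} y"
    using uniq \<open>0 < c\<close> unfolding unique_finite_sums_def sum_y by simp
  moreover have "{\<Sum>t\<in>F. y t |F. F \<noteq> {} \<and> F \<subseteq> {1..k}} \<subseteq> B"
    unfolding sum_y using sums assms(2) by blast
  ultimately show ?thesis unfolding k_summable_def by blast
qed

lemma k_summable_mono: "k_summable k A \<Longrightarrow> A \<subseteq> B \<Longrightarrow> k_summable k B"
  using k_summable_scale[of k A 1 B] by simp

lemma k_summable_2E:
  assumes "k_summable 2 A"
  obtains x y where "x \<in> A" "y \<in> A" "x + y \<in> A"
proof -
  obtain x :: "nat \<Rightarrow> nat" where "{\<Sum>t\<in>F. x t |F. F \<noteq> {} \<and> F \<subseteq> {1..2}} \<subseteq> A"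
    using assms unfolding k_summable_def by blast
  then have mem: "(\<Sum>t\<in>F. x t) \<in> A" if "F \<noteq> {}" "F \<subseteq> {1..2}" for F
    using that by blast
  show thesis
  proof (rule that)
    show "x 1 \<in> A" "x 2 \<in> A" "x 1 + x 2 \<in> A"
      using mem[of "{1}"] mem[of "{2}"] mem[of "{1, 2}"] by simp_all
  qed
qed

lemma k_summable_3E:
  assumes "k_summable 3 A"
  obtains x y z where "x \<in> A" "y \<in> A" "z \<in> A" "x + y \<in> A" "x + z \<in> A" "x + y + z \<in> A"
proof -
  obtain x :: "nat \<Rightarrow> nat" where "{\<Sum>t\<in>F. x t |F. F \<noteq> {} \<and> F \<subseteq> {1..3}} \<subseteq> A"
    using assms unfolding k_summable_def by blast
  then have mem: "(\<Sum>t\<in>F. x t) \<in> A" if "F \<noteq> {}" "F \<subseteq> {1..3}" for F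
    using that by blast
  show thesis
  proof (rule that)
    show "x 1 \<in> A" "x 2 \<in> A" "x 3 \<in> A" "x 1 + x 2 \<in> A" "x 1 + x 3 \<in> A" "x 1 + x 2 + x 3 \<in> A"
      using mem[of "{1}"] mem[of "{2}"] mem[of "{3}"] mem[of "{1, 2}"] mem[of "{1, 3}"]
        mem[of "{1, 2, 3}"] by (simp_all add: add.assoc)
  qed
qed

text \<open>Since \<open>0 < a < b\<close>, the three sums \<open>a\<close>, \<open>b\<close> and
  \<open>a + b\<close> are distinct.\<close>

lemma k_summable_2I:
  assumes "a \<in> A" "b \<in> A" "a + b \<in> A" "0 < a" "a < b"
  shows "k_summable 2 A"
proof -
  define x where "x t = (if t = 1 then a else b)" for t :: nat
  have 12: "{1..2::nat} = {1, 2}" by auto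
  have F: "F = {} \<or> F = {1} \<or> F = {2} \<or> F = {1, 2}" if "F \<subseteq> {1..2::nat}" for F
    using that unfolding 12 by blast
  have sum_simps: "sum x {1} = a" "sum x {2} = b" "sum x {1, 2} = a + b"
    by (simp_all add: x_def)
  have "unique_finite_sums {1..2} x"
    unfolding unique_finite_sums_def
  proof (intro allI impI, elim conjE)
    fix F H :: "nat set"
    assume "F \<subseteq> {1..2}" "H \<subseteq> {1..2}" "F \<noteq> {}" "H \<noteq> {}" and eq: "sum x F = sum x H"
    then have "F = {1} \<or> F = {2} \<or> F = {1, 2}" "H = {1} \<or> H = {2} \<or> H = {1, 2}"
      using F by blast+
    then show "F = H"
      using eq assms sum_simps by (elim disjE) simp_all
  qed
  moreover have "{\<Sum>t\<in>F. x t |F. F \<noteq> {} \<and> F \<subseteq> {1..2}} \<subseteq> A"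
    using F sum_simps assms(1-3) by clarify (metis One_nat_def)
  ultimately show ?thesis
    using assms(4,5) unfolding k_summable_def by (intro exI[of _ x]) (auto simp: x_def)
qed

lemma not_summable_if_odd:
  assumes "\<And>n. n \<in> A \<Longrightarrow> odd n"
  shows "\<not> k_summable 2 A" "\<not> k_summable 3 A"
proof -
  have "\<not> (x \<in> A \<and> y \<in> A \<and> x + y \<in> A)" for x y
    using assms[of x] assms[of y] assms[of "x + y"] by auto
  then show "\<not> k_summable 2 A" "\<not> k_summable 3 A"
    by (blast elim: k_summable_2E k_summable_3E)+
qed

text \<open>Two residues from {2, 3} have their sum in these classes only if both are 3. Hence all
  three numbers are 3 modulo 4, and their total is 1 modulo 4.\<close>

lemma not_3_summable_mod_4:
  assumes "\<And>n. n \<in> A \<Longrightarrow> n mod 4 = 2 \<or> n mod 4 = 3"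
  shows "\<not> k_summable 3 A"
proof
  assume "k_summable 3 A"
  then obtain x y z where "x \<in> A" "y \<in> A" "z \<in> A" "x + y \<in> A" "x + z \<in> A" "x + y + z \<in> A"
    by (rule k_summable_3E)
  then have mems: "x mod 4 = 2 \<or> x mod 4 = 3" "y mod 4 = 2 \<or> y mod 4 = 3"
    "z mod 4 = 2 \<or> z mod 4 = 3" "(x + y) mod 4 = 2 \<or> (x + y) mod 4 = 3"
    "(x + z) mod 4 = 2 \<or> (x + z) mod 4 = 3" "(x + y + z) mod 4 = 2 \<or> (x + y + z) mod 4 = 3"
    using assms by blast+
  define a b c where "a = x mod 4" and "b = y mod 4" and "c = z mod 4"
  note abc = this
  have "(x + y) mod 4 = (a + b) mod 4" "(x + z) mod 4 = (a + c) mod 4"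
    "(x + y + z) mod 4 = (a + b + c) mod 4"
    unfolding abc by (metis mod_add_eq mod_add_left_eq)+
  then show False
    using mems unfolding abc[symmetric] by (elim disjE) simp_all
qed

text \<open>Each term exceeds the sum of all earlier ones, so the largest index at which two index
  sets differ decides which sum is larger.\<close>

lemma unique_finite_sums_if_doubling:
  assumes pos: "0 < x 1" and double: "\<And>t. 1 \<le> t \<Longrightarrow> 2 * x t \<le> x (Suc t)"
  shows "unique_finite_sums {1..} x"
proof -
  have partial: "(\<Sum>t\<in>{1..n}. x t) < x (Suc n)" for n
  proof (induction n)
    case 0
    then show ?case using pos by simp
  next
    case (Suc n)
    then show ?case using double[of "Suc n"] by simp
  qed
  have upper: "sum x F < x n" if "F \<subseteq> {1..<n}" "1 \<le> n" for F n
  proof -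
    obtain k where k: "n = Suc k" using \<open>1 \<le> n\<close> by (cases n) auto
    have "sum x F \<le> sum x {1..k}"
      using that k by (intro sum_mono2) auto
    then show ?thesis using partial[of k] k by simp
  qed
  have less: "sum x F < sum x H"
    if fin: "finite F" "finite H" and F: "F \<subseteq> {1..}" and H: "H \<subseteq> {1..}"
      and d: "d \<in> H" "d \<notin> F" and agree: "\<And>t. d < t \<Longrightarrow> t \<in> F \<longleftrightarrow> t \<in> H" for F H d
  proof -
    \<comment> \<open>\<open>C\<close> is the part above \<open>d\<close>, common to both sets; the
      elements of \<open>F\<close> below \<open>d\<close> contribute less than
      \<open>x d\<close>.\<close>
    define C where "C = {t \<in> H. d < t}"
    have "F = (F \<inter> {..<d}) \<union> C"
      using agree d unfolding C_def by (auto dest: linorder_neqE_nat) (metis linorder_neqE_nat)+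
    then have "sum x F = sum x ((F \<inter> {..<d}) \<union> C)" by simp
    also have "\<dots> = sum x (F \<inter> {..<d}) + sum x C"
      using fin by (intro sum.union_disjoint) (auto simp: C_def)
    also have "\<dots> < x d + sum x C"
      using F H d by (intro add_strict_right_mono upper) auto
    also have "\<dots> = sum x (insert d C)"
      using fin by (simp add: C_def)
    also have "\<dots> \<le> sum x H"
      using fin d by (intro sum_mono2) (auto simp: C_def)
    finally show ?thesis .
  qed
  show ?thesis
    unfolding unique_finite_sums_def
  proof (intro allI impI, elim conjE, rule ccontr)
    fix F H assume FH: "finite F" "finite H" "F \<subseteq> {1..}" "H \<subseteq> {1..}" "sum x F = sum x H" "F \<noteq> H"
    define D where "D = (F - H) \<union> (H - F)"
    have D: "finite D" "D \<noteq> {}" using FH by (auto simp: D_def)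
    define d where "d = Max D"
    have "d \<in> D" using D by (simp add: d_def)
    moreover have agree: "t \<in> F \<longleftrightarrow> t \<in> H" if "d < t" for t
      using that Max_ge[OF D(1), of t] by (auto simp: D_def d_def)
    ultimately show False
      using less[of F H d] less[of H F d] FH by (auto simp: D_def)
  qed
qed

subsection \<open>Prefixes of the Thue-Morse word and of its complement\<close>

lemma IP_set_prefix:
  assumes "word_prefix u thue_morse"
  shows "IP_set (occurrences thue_morse u)"
proof -
  define m where "m = length u"
  \<comment> \<open>The factor \<open>2 ^ m\<close> clears the lowest \<open>m\<close> digits, so
    adding an offset \<open>k < length u\<close> causes no carry.\<close>
  define x :: "nat \<Rightarrow> nat" where "x t = 2 ^ m * (3 * 4 ^ t)" for t
  have "(\<Sum>t\<in>F. x t) \<in> occurrences thue_morse u" if F: "finite F" "F \<noteq> {}" for F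
  proof -
    have eq: "(\<Sum>t\<in>F. x t) = 2 ^ m * (\<Sum>t\<in>F. 3 * 4 ^ t)"
      by (simp add: x_def sum_distrib_left)
    have "thue_morse (2 ^ m * (\<Sum>t\<in>F. 3 * 4 ^ t) + k) = u ! k" if "k < length u" for k
    proof -
      have "k < 2 ^ m"
        using that order.strict_trans[OF _ less_exp[of m]] by (simp add: m_def)
      then show ?thesis
        using thue_morse_add_no_carry[of k m] thue_morse_sum_power_4[OF F(1)] assms that
          thue_morse_le_1[of k] by (simp add: word_prefix_def occurs_at_iff_nth)
    qed
    moreover have "0 < (\<Sum>t\<in>F. x t)" using F by (intro sum_pos) (auto simp: x_def)
    ultimately show ?thesis by (simp add: occurrences_def occurs_at_iff_nth eq)
  qed
  then show ?thesis
    unfolding IP_set_def by (intro exI[of _ x]) (auto simp: x_def)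
qed

lemma infinite_FS_big_prefix_bar:
  assumes "word_prefix u thue_morse_bar"
  shows "infinite_FS_big (occurrences thue_morse u)"
  unfolding infinite_FS_big_def
proof (intro allI impI)
  fix k :: nat
  assume "0 < k"
  define m where "m = length u"
  \<comment> \<open>Oddness gives the multiples of \<open>d\<close> digit parity 1; the size gives
    \<open>k < 2 ^ K\<close>.\<close>
  define K where "K = Suc (2 * k)"
  define d :: nat where "d = 2 ^ K - 1"
  \<comment> \<open>Sums of at most \<open>k\<close> terms have three digit zones: the lowest
    \<open>m\<close> digits are free for offsets in \<open>u\<close>, the next \<open>2 * K\<close>
    hold a multiple of \<open>d\<close>, and the blocks 11 lie above.\<close>
  define x :: "nat \<Rightarrow> nat" where "x t = 2 ^ m * (2 ^ (2 * K) * (3 * 4 ^ t) + d)" for t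
  have k_less: "k < 2 ^ K"
    by (rule order.strict_trans[OF _ less_exp]) (simp add: K_def)
  have d_less: "d < 2 ^ K" by (simp add: d_def)
  have "(2::nat) ^ K \<le> 2 ^ (2 * K)" by (intro power_increasing) auto
  then have d_le: "d \<le> 2 ^ (2 * K)" using d_less by linarith
  have x_pos: "0 < x t" for t by (simp add: x_def)
  have "unique_finite_sums {1..} x"
  proof (rule unique_finite_sums_if_doubling)
    fix t :: nat
    \<comment> \<open>What remains of the doubling condition after cancelling common terms.\<close>
    have "d \<le> 2 ^ (2 * K) * (6 * 4 ^ t)"
      using d_le by (rule order_trans) simp
    then have "2 * (2 ^ (2 * K) * (3 * 4 ^ t) + d) \<le> 2 ^ (2 * K) * (3 * 4 ^ Suc t) + d"
      by (simp add: mult.commute mult.left_commute)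
    then have "2 ^ m * (2 * (2 ^ (2 * K) * (3 * 4 ^ t) + d))
        \<le> 2 ^ m * (2 ^ (2 * K) * (3 * 4 ^ Suc t) + d)"
      by (rule mult_le_mono2)
    then show "2 * x t \<le> x (Suc t)" by (simp only: x_def mult.left_commute)
  qed (rule x_pos)
  moreover have "(\<Sum>t\<in>F. x t) \<in> occurrences thue_morse u"
    if F: "finite F" "F \<noteq> {}" "card F \<le> k" for F
  proof -
    define S :: nat where "S = (\<Sum>t\<in>F. 3 * 4 ^ t)"
    define q where "q = 2 ^ (2 * K) * S + card F * d"
    have eq: "(\<Sum>t\<in>F. x t) = 2 ^ m * q"
      by (simp add: x_def S_def q_def sum_distrib_left[symmetric] sum.distrib)
    have "card F * d < 2 ^ K * 2 ^ K"
      using k_less d_less F(3) by (intro mult_strict_mono) auto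
    then have "card F * d < 2 ^ (2 * K)" by (simp add: power_add[symmetric] mult_2)
    moreover have "thue_morse (card F * d) = 1"
      unfolding d_def using F k_less thue_morse_mult_mersenne[of "card F" K]
      by (simp add: card_gt_0_iff K_def del: power_Suc)
    \<comment> \<open>The blocks 11 contribute parity 0, the multiple of \<open>d\<close> parity
      1.\<close>
    ultimately have q: "thue_morse q = 1"
      using thue_morse_add_no_carry thue_morse_sum_power_4[OF F(1)] by (simp add: q_def S_def)
    have "thue_morse (2 ^ m * q + i) = u ! i" if "i < length u" for i
    proof -
      have "i < 2 ^ m"
        using that order.strict_trans[OF _ less_exp[of m]] by (simp add: m_def)
      moreover have "u ! i = 1 - thue_morse i"
        using assms that by (simp add: word_prefix_def occurs_at_iff_nth thue_morse_bar_def)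
      moreover have "(1 + a) mod 2 = 1 - a" if "a \<le> 1" for a :: nat
        using that by presburger
      ultimately show ?thesis
        using thue_morse_add_no_carry[of i m q] q thue_morse_le_1[of i] by simp
    qed
    moreover have "0 < (\<Sum>t\<in>F. x t)" using F x_pos by (intro sum_pos) auto
    ultimately show ?thesis by (simp add: occurrences_def occurs_at_iff_nth eq)
  qed
  ultimately show "k_inf_summable k (occurrences thue_morse u)"
    unfolding k_inf_summable_def using x_pos by (intro exI[of _ x]) auto
qed

text \<open>Pigeonhole: two of the \<open>M + 1\<close> partial sums of lengths 0 to
  \<open>M\<close> agree modulo \<open>M\<close>, and their difference is an interval sum.\<close>

lemma exists_interval_sum_dvd:
  fixes x :: "nat \<Rightarrow> nat"
  assumes "0 < M"
  obtains a b where "a < b" "M dvd (\<Sum>t\<in>{a..<b}. x (t + c))"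
proof -
  define s where "s n = (\<Sum>t<n. x (t + c)) mod M" for n
  have "\<not> inj_on s {..M}"
  proof
    assume "inj_on s {..M}"
    then have "card {..M} \<le> card {..<M}"
      using assms by (intro card_inj_on_le) (auto simp: s_def)
    then show False by simp
  qed
  then obtain a b where ab: "a < b" "s a = s b"
    unfolding inj_on_def by (metis linorder_neqE_nat)
  have "(\<Sum>t<b. x (t + c)) = (\<Sum>t<a. x (t + c)) + (\<Sum>t\<in>{a..<b}. x (t + c))"
    using ab(1) by (simp add: lessThan_atLeast0 sum.atLeastLessThan_concat)
  then have "M dvd (\<Sum>t\<in>{a..<b}. x (t + c))"
    using ab(2) unfolding s_def by (metis add_diff_cancel_left' mod_eq_dvd_iff_nat le_add1)
  with ab(1) show thesis by (rule that)
qed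

lemma not_IP_set_thue_morse_1:
  assumes "\<And>n. n \<in> A \<Longrightarrow> thue_morse n = 1"
  shows "\<not> IP_set A"
proof
  assume "IP_set A"
  then obtain x :: "nat \<Rightarrow> nat"
    where sums: "{\<Sum>t\<in>F. x t |F. finite F \<and> F \<noteq> {} \<and> F \<subseteq> {1..}} \<subseteq> A"
    unfolding IP_set_def by blast
  have one: "thue_morse (\<Sum>t\<in>F. x t) = 1" if "finite F" "F \<noteq> {}" "F \<subseteq> {1..}" for F
    using sums that assms by blast
  \<comment> \<open>This is large enough because \<open>x 1 < 2 ^ x 1\<close>.\<close>
  define m where "m = x 1"
  \<comment> \<open>The shift by 2 starts the indices at 2, so that \<open>x 1\<close> can be added
    as a new term.\<close>
  obtain a b where ab: "a < b" and dvd: "2 ^ m dvd (\<Sum>t\<in>{a..<b}. x (t + 2))"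
    by (rule exists_interval_sum_dvd[of "2 ^ m" x 2]) simp
  define F where "F = {a + 2..<b + 2}"
  have F: "finite F" "F \<noteq> {}" "F \<subseteq> {1..}" "1 \<notin> F" using ab by (auto simp: F_def)
  obtain q where q: "(\<Sum>t\<in>F. x t) = 2 ^ m * q"
    using dvd unfolding F_def sum.shift_bounds_nat_ivl by (rule dvdE)
  have "thue_morse q = 1"
    using one[OF F(1-3)] thue_morse_add_no_carry[of 0 m q] thue_morse_le_1[of q] by (simp add: q)
  moreover have "thue_morse (x 1) = 1" using one[of "{1}"] by simp
  moreover have "(\<Sum>t\<in>insert 1 F. x t) = 2 ^ m * q + x 1"
    using F q by simp
  moreover have "thue_morse (\<Sum>t\<in>insert 1 F. x t) = 1"
    using F by (intro one) auto
  moreover have "x 1 < 2 ^ m" by (simp add: m_def less_exp)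
  ultimately show False
    using thue_morse_add_no_carry[of "x 1" m q] by simp
qed

subsection \<open>Other factors\<close>

text \<open>The letters at \<open>n\<close> and \<open>n + 2\<close> are those at
  \<open>i = n div 2\<close> and \<open>Suc i\<close>, or both their complements. They are equal, so
  a square starts at \<open>i\<close> and \<open>i\<close> is odd.\<close>

lemma occurrences_alternating_mod_4:
  assumes "occurs_at [a, b, a] thue_morse n" "a \<noteq> b"
  shows "n mod 4 = 2 \<or> n mod 4 = 3"
proof -
  define i where "i = n div 2"
  have "odd i"
  proof (cases "even n")
    case True
    then have "n = 2 * i" by (simp add: i_def)
    then show ?thesis
      using assms thue_morse_double[of "Suc i"] by (intro thue_morse_square_odd) simp
  next
    case False
    then have "n = Suc (2 * i)" by (simp add: i_def)
    then have "1 - thue_morse i = 1 - thue_morse (Suc i)"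
      using assms thue_morse_Suc_double[of "Suc i"] by simp
    then show ?thesis
      using thue_morse_le_1[of i] thue_morse_le_1[of "Suc i"]
      by (intro thue_morse_square_odd) linarith
  qed
  then show ?thesis unfolding i_def by presburger
qed

text \<open>An occurrence at \<open>n\<close> yields one of the \<open>tau\<close> image at
  \<open>2 * n\<close>, so only the words of length 3 need explicit witnesses.\<close>

lemma k_summable_2_tau_power:
  assumes "u \<in> {[0, 1, 0], [1, 0, 1]}"
  shows "k_summable 2 (occurrences thue_morse ((tau ^^ n) u))"
proof (induction n)
  case 0
  \<comment> \<open>010 occurs at 3, 15 and 18; 101 occurs at 19, 79 and 98.\<close>
  have "k_summable 2 (occurrences thue_morse [0, 1, 0])"
    by (rule k_summable_2I[of 3 _ 15]) (simp_all add: occurrences_def)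
  moreover have "k_summable 2 (occurrences thue_morse [1, 0, 1])"
    by (rule k_summable_2I[of 19 _ 79]) (simp_all add: occurrences_def)
  ultimately show ?case using assms by auto
next
  case (Suc n)
  have "(*) 2 ` occurrences thue_morse ((tau ^^ n) u) \<subseteq> occurrences thue_morse ((tau ^^ Suc n) u)"
    using occurs_at_tau_thue_morse by (auto simp: occurrences_def)
  with Suc show ?case by (rule k_summable_scale) simp
qed

lemma summability_non_prefix:
  assumes "word_factor u thue_morse" "\<not> word_prefix u thue_morse" "\<not> word_prefix u thue_morse_bar"
  shows "\<not> k_summable 3 (occurrences thue_morse u) \<and>
    (k_summable 2 (occurrences thue_morse u) \<longrightarrow>
      (\<exists>n. prefix u ((tau ^^ n) [0, 1, 0]) \<or> prefix u ((tau ^^ n) [1, 0, 1])))"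
  using assms
proof (induction "length u" arbitrary: u rule: less_induct)
  case less
  obtain p where p: "occurs_at u thue_morse p"
    using less.prems(1) by (auto simp: word_factor_def)
  show ?case
  proof (cases "4 \<le> length u")
    case long: True
    show ?thesis
    proof (cases "even p")
      case False
      then have "odd n" if "n \<in> occurrences thue_morse u" for n
        using that occurs_at_same_parity[OF long _ p] by (auto simp: occurrences_def)
      then show ?thesis using not_summable_if_odd by blast
    next
      case True
      then obtain i where i: "p = 2 * i" by blast
      \<comment> \<open>The length is rounded up, so that \<open>tau v\<close> covers
        \<open>u\<close> also when \<open>length u\<close> is odd.\<close>
      define v where "v = map thue_morse [i..<i + (length u + 1) div 2]"
      have len_v: "length v = (length u + 1) div 2" by (simp add: v_def)
      have occ_v: "occurs_at v thue_morse i" by (simp add: v_def occurs_at_iff_nth)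
      have u_tau_v: "prefix u (tau v)"
        using p occurs_at_tau_thue_morse[OF occ_v] i
        by (intro prefix_if_occurs_at[of u thue_morse p]) (auto simp: length_tau len_v)
      have sub: "occurrences thue_morse u \<subseteq> (*) 2 ` occurrences thue_morse v"
      proof
        fix n assume n: "n \<in> occurrences thue_morse u"
        then have "even n"
          using occurs_at_same_parity[OF long p] True by (auto simp: occurrences_def)
        then obtain j where j: "n = 2 * j" by blast
        \<comment> \<open>Letter \<open>k\<close> of \<open>v\<close> is letter \<open>2 * k\<close>
          of \<open>u\<close>, so an occurrence of \<open>u\<close> at \<open>2 * j\<close> gives
          one of \<open>v\<close> at \<open>j\<close>.\<close>
        have "thue_morse (j + k) = v ! k" if "k < length v" for k
        proof -
          have k: "2 * k < length u" using that by (simp add: len_v)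
          have "thue_morse (j + k) = thue_morse (2 * j + 2 * k)"
            by (simp flip: thue_morse_double[of "j + k"])
          also have "\<dots> = u ! (2 * k)"
            using n k j by (simp add: occurrences_def occurs_at_iff_nth)
          also have "\<dots> = thue_morse (2 * i + 2 * k)"
            using p k i by (simp add: occurs_at_iff_nth)
          also have "\<dots> = thue_morse (i + k)"
            by (simp flip: thue_morse_double[of "i + k"])
          finally show ?thesis using that occ_v by (simp add: occurs_at_iff_nth)
        qed
        then show "n \<in> (*) 2 ` occurrences thue_morse v"
          using n j by (auto simp: occurrences_def occurs_at_iff_nth)
      qed
      \<comment> \<open>Being a prefix of either infinite word would pass from \<open>v\<close> to
        \<open>tau v\<close> and then to \<open>u\<close>.\<close>
      have "\<not> word_prefix v thue_morse" "\<not> word_prefix v thue_morse_bar"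
        using less.prems(2,3) word_prefix_tau_thue_morse word_prefix_tau_thue_morse_bar
          occurs_at_prefix[OF u_tau_v] by (auto simp: word_prefix_def)
      moreover have "word_factor v thue_morse" using occ_v by (auto simp: word_factor_def)
      moreover have "length v < length u" using long by (simp add: len_v)
      ultimately have IH: "\<not> k_summable 3 (occurrences thue_morse v)"
        "k_summable 2 (occurrences thue_morse v) \<Longrightarrow>
          \<exists>n. prefix v ((tau ^^ n) [0, 1, 0]) \<or> prefix v ((tau ^^ n) [1, 0, 1])"
        using less.hyps by blast+
      have "\<not> k_summable 3 (occurrences thue_morse u)"
        using IH(1) k_summable_scaleD[OF _ sub] by auto
      moreover have "\<exists>n. prefix u ((tau ^^ n) [0, 1, 0]) \<or> prefix u ((tau ^^ n) [1, 0, 1])"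
        if "k_summable 2 (occurrences thue_morse u)"
      proof -
        have "k_summable 2 (occurrences thue_morse v)"
          using k_summable_scaleD[OF that sub] by simp
        then obtain n where "prefix v ((tau ^^ n) [0, 1, 0]) \<or> prefix v ((tau ^^ n) [1, 0, 1])"
          using IH(2) by blast
        then have "prefix u ((tau ^^ Suc n) [0, 1, 0]) \<or> prefix u ((tau ^^ Suc n) [1, 0, 1])"
          using u_tau_v prefix_tau prefix_order.trans by (metis comp_apply funpow.simps(2))
        then show ?thesis by blast
      qed
      ultimately show ?thesis by blast
    qed
  next
    case False
    have le1: "u ! k \<le> 1" if "k < length u" for k
      using that p thue_morse_le_1 by (metis occurs_at_iff_nth)
    \<comment> \<open>The empty word, single letters, 01 and 10 are prefixes and hence excluded; an
      initial square confines occurrences to odd positions.\<close>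
    consider "u = []" | a where "u = [a]" | a b v where "u = a # b # v" "a = b"
      | a b where "u = [a, b]" "a \<noteq> b" | a b c where "u = [a, b, c]" "a \<noteq> b"
      using False by (cases u; cases "tl u"; cases "tl (tl u)"; cases "tl (tl (tl u))") auto
    then show ?thesis
    proof cases
      case 1
      then show ?thesis using less.prems by (simp add: word_prefix_def)
    next
      case (2 a)
      then have "a = 0 \<or> a = 1" using le1[of 0] by auto
      then show ?thesis using 2 less.prems by (auto simp: word_prefix_def thue_morse_bar_def)
    next
      case (3 a b v)
      then have "odd n" if "n \<in> occurrences thue_morse u" for n
        using that by (auto simp: occurrences_def intro!: thue_morse_square_odd)
      then show ?thesis using not_summable_if_odd by blast
    next
      case (4 a b)
      then have "a = 0 \<and> b = 1 \<or> a = 1 \<and> b = 0" using le1[of 0] le1[of 1] by auto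
      then show ?thesis using 4 less.prems by (auto simp: word_prefix_def thue_morse_bar_def)
    next
      case (5 a b c)
      then have "a = 0 \<and> b = 1 \<or> a = 1 \<and> b = 0" "c = 0 \<or> c = 1"
        using le1[of 0] le1[of 1] le1[of 2] by auto
      \<comment> \<open>Hence 011 is a prefix of the Thue-Morse word and 100 of its complement,
        which leaves 010 and 101.\<close>
      moreover have "thue_morse (Suc (Suc 0)) = 1"
        using thue_morse_numeral(3)[of Num.One] by (simp add: numeral_2_eq_2)
      ultimately have u: "u = [0, 1, 0] \<or> u = [1, 0, 1]"
        using 5 less.prems by (auto simp: word_prefix_def thue_morse_bar_def)
      then have "n mod 4 = 2 \<or> n mod 4 = 3" if "n \<in> occurrences thue_morse u" for n
        using that occurrences_alternating_mod_4[of 0 1 n] occurrences_alternating_mod_4[of 1 0 n]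
        by (auto simp: occurrences_def)
      then have "\<not> k_summable 3 (occurrences thue_morse u)"
        by (rule not_3_summable_mod_4)
      moreover have "prefix u ((tau ^^ 0) [0, 1, 0]) \<or> prefix u ((tau ^^ 0) [1, 0, 1])"
        using u by auto
      ultimately show ?thesis by blast
    qed
  qed
qed

theorem theorem7:
  fixes u :: "nat list"
  assumes "u \<noteq> []"
    and "word_factor u thue_morse"
  shows "(word_prefix u thue_morse \<longrightarrow> IP_set (occurrences thue_morse u)) \<and>
    (word_prefix u thue_morse_bar \<longrightarrow>
       infinite_FS_big (occurrences thue_morse u) \<and> \<not> IP_set (occurrences thue_morse u)) \<and>
    (\<not> word_prefix u thue_morse \<and> \<not> word_prefix u thue_morse_bar \<longrightarrow>
       \<not> k_summable 3 (occurrences thue_morse u) \<and>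
       (k_summable 2 (occurrences thue_morse u) \<longleftrightarrow>
          (\<exists>n. prefix u ((tau ^^ n) [0, 1, 0]) \<or> prefix u ((tau ^^ n) [1, 0, 1]))))"
proof -
  \<comment> \<open>A nonempty prefix of the complement begins with 1, so \<open>u\<close> occurs
    only at positions with letter 1.\<close>
  have "\<not> IP_set (occurrences thue_morse u)" if "word_prefix u thue_morse_bar"
  proof (rule not_IP_set_thue_morse_1)
    fix n assume "n \<in> occurrences thue_morse u"
    then show "thue_morse n = 1"
      using that assms(1)
      by (cases u) (auto simp: occurrences_def word_prefix_def thue_morse_bar_def)
  qed
  moreover have "k_summable 2 (occurrences thue_morse u)"
    if "prefix u ((tau ^^ n) v)" "v \<in> {[0, 1, 0], [1, 0, 1]}" for n v
    using k_summable_2_tau_power[OF that(2), of n]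
    by (rule k_summable_mono) (use that(1) occurs_at_prefix in \<open>auto simp: occurrences_def\<close>)
  ultimately show ?thesis
    using IP_set_prefix infinite_FS_big_prefix_bar summability_non_prefix[OF assms(2)] by blast
qed

end
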